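(* Let $r\ge 1$ be an integer, let $\alpha=(\alpha_0,\alpha_1,\dots,\alpha_r)$ be a vector of real numbers with $\alpha_i\ge 0$ (independent of $n$), and let $s$ be an integer satisfying $0\le s\le r$. Let $$D_s(\alpha)=\sum_{i=0}^r\frac{\binom{s+1}{i+1}}{s+1}\,\alpha_i .$$ (1) If $D_s(\alpha)<1$, then the dimension of a random complex $Y\in Y_r(n,n^{-\alpha})$ satisfies $\dim Y\ge s$, a.a.s. (2) If $D_s(\alpha)>1$, then the dimension of a random complex $Y\in Y_r(n,n^{-\alpha})$ satisfies $\dim Y<s$, a.a.s. (3) The convex domain given by the inequalities $$D_s(\alpha)<1<D_{s+1}(\alpha),\quad\text{and}\quad \alpha_0\ge 0,\ \alpha_1\ge 0,\ \dots,\ \alpha_r\ge 0$$ describes the area of the multi-parameter $\alpha\in\mathbf R^{r+1}$ such that the dimension of a random complex $Y\in Y_r(n,n^{-\alpha})$ satisfies $\dim Y=s$, a.a.s.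
   Context: Random complex: let $\Delta_n$ be the simplex with vertex set $\{1,\dots,n\}$, viewed as an abstract simplicial complex, and let $\Delta_n^{(r)}$ be its $r$-skeleton. For a subcomplex $Y\subset\Delta_n^{(r)}$ (the empty subcomplex is allowed, with dimension $-1$) let $f_i(Y)$ be the number of $i$-dimensional simplexes of $Y$, and let $e_i(Y)$ be the number of $i$-dimensional external faces of $Y$, where an external face of $Y$ is a simplex $\sigma\subset\Delta_n$ with $\sigma\not\subset Y$ but $\partial\sigma\subset Y$ (the boundary of a vertex is empty, so $e_0(Y)=n-f_0(Y)$). For $\mathbf p=(p_0,\dots,p_r)$ with $0\le p_i\le 1$ and $q_i=1-p_i$, $Y_r(n,\mathbf p)$ denotes the probability space of all subcomplexes $Y\subset\Delta_n^{(r)}$ with probability function $\mathbb P_r(Y)=\prod_{i=0}^r p_i^{f_i(Y)}\prod_{i=0}^r q_i^{e_i(Y)}$ (convention $0^0=1$). For $\alpha=(\alpha_0,\dots,\alpha_r)$, $n^{-\alpha}$ denotes the multiparameter $\mathbf p=(n^{-\alpha_0},\dots,n^{-\alpha_r})$. "a.a.s." means with probability tending to $1$ as $n\to\infty$. The quantities $D_s(\alpha)$ are defined by the displayed formula for $s=0,1,\dots,r$, where $\binom{s+1}{i+1}=0$ for $i>s$; $D_{s+1}(\alpha)$ in (3) is the same expression with $s+1$ in place of $s$.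
   Formalization: In (3) the domain is shown to equal the area where dim Y = s a.a.s. only for s < r; for s = r only that the domain lies in the area, since equality fails there: α = 0 gives dim Y = r a.a.s. but D_{r+1}(0) = 0 < 1. *)

theory Defs
  imports "HOL-Probability.Probability"
begin

text \<open>
  A simplex is represented by its nonempty vertex set, so \<open>\<sigma>\<close> has dimension \<open>card \<sigma> - 1\<close>.
  Complexes are sets of such nonempty sets; the empty simplex is never an element.
\<close>

definition skeleton :: "nat \<Rightarrow> nat \<Rightarrow> nat set set" where
  "skeleton n r = {\<sigma>. \<sigma> \<subseteq> {1..n} \<and> \<sigma> \<noteq> {} \<and> card \<sigma> \<le> Suc r}"

definition subcomplexes :: "nat \<Rightarrow> nat \<Rightarrow> nat set set set" where
  "subcomplexes n r =
     {Y. Y \<subseteq> skeleton n r \<and> (\<forall>\<sigma>\<in>Y. \<forall>\<tau>. \<tau> \<noteq> {} \<and> \<tau> \<subseteq> \<sigma> \<longrightarrow> \<tau> \<in> Y)}"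

definition bdry :: "nat set \<Rightarrow> nat set set" where
  "bdry \<sigma> = {\<tau>. \<tau> \<noteq> {} \<and> \<tau> \<subset> \<sigma>}"

definition external_faces :: "nat \<Rightarrow> nat set set \<Rightarrow> nat set set" where
  "external_faces n Y = {\<sigma>. \<sigma> \<subseteq> {1..n} \<and> \<sigma> \<noteq> {} \<and> \<sigma> \<notin> Y \<and> bdry \<sigma> \<subseteq> Y}"

definition f_num :: "nat \<Rightarrow> nat set set \<Rightarrow> nat" where
  "f_num i Y = card {\<sigma> \<in> Y. card \<sigma> = Suc i}"

definition e_num :: "nat \<Rightarrow> nat \<Rightarrow> nat set set \<Rightarrow> nat" where
  "e_num n i Y = card {\<sigma> \<in> external_faces n Y. card \<sigma> = Suc i}"

definition complex_dim :: "nat set set \<Rightarrow> int" where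
  "complex_dim Y = (if Y = {} then - 1 else int (Max (card ` Y)) - 1)"

text \<open>
  The multiparameters \<open>(p\<^sub>0, \<dots>, p\<^sub>r)\<close> and \<open>(\<alpha>\<^sub>0, \<dots>, \<alpha>\<^sub>r)\<close> are functions on \<^typ>\<open>nat\<close> of which
  only the values at indices \<open>i \<le> r\<close> are ever used.
\<close>

definition prob_fun :: "nat \<Rightarrow> nat \<Rightarrow> (nat \<Rightarrow> real) \<Rightarrow> nat set set \<Rightarrow> real" where
  "prob_fun n r p Y = (\<Prod>i\<le>r. p i ^ f_num i Y) * (\<Prod>i\<le>r. (1 - p i) ^ e_num n i Y)"

definition random_complex :: "nat \<Rightarrow> nat \<Rightarrow> (nat \<Rightarrow> real) \<Rightarrow> nat set set measure" where
  "random_complex n r p = point_measure (subcomplexes n r) (\<lambda>Y. ennreal (prob_fun n r p Y))"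

definition aas :: "nat \<Rightarrow> (nat \<Rightarrow> real) \<Rightarrow> (nat set set \<Rightarrow> bool) \<Rightarrow> bool" where
  "aas r \<alpha> Q \<longleftrightarrow>
     (\<lambda>n. \<P>(Y in random_complex n r (\<lambda>i. real n powr (- \<alpha> i)). Q Y)) \<longlonglongrightarrow> 1"

definition D :: "nat \<Rightarrow> nat \<Rightarrow> (nat \<Rightarrow> real) \<Rightarrow> real" where
  "D r s \<alpha> = (\<Sum>i\<le>r. real (Suc s choose Suc i) / real (Suc s) * \<alpha> i)"

definition dim_domain :: "nat \<Rightarrow> nat \<Rightarrow> (nat \<Rightarrow> real) set" where
  "dim_domain r s = {\<alpha>. (\<forall>i\<le>r. 0 \<le> \<alpha> i) \<and> D r s \<alpha> < 1 \<and> 1 < D r (Suc s) \<alpha>}"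

definition dim_area :: "nat \<Rightarrow> nat \<Rightarrow> (nat \<Rightarrow> real) set" where
  "dim_area r s = {\<alpha>. (\<forall>i\<le>r. 0 \<le> \<alpha> i) \<and> aas r \<alpha> (\<lambda>Y. complex_dim Y = int s)}"

text \<open>
  Convexity spelled out pointwise, since function types carry no \<^class>\<open>real_vector\<close> structure
  here, so the library's \<open>convex\<close> does not apply.
\<close>

definition convex_params :: "(nat \<Rightarrow> real) set \<Rightarrow> bool" where
  "convex_params S \<longleftrightarrow>
     (\<forall>\<alpha>\<in>S. \<forall>\<beta>\<in>S. \<forall>u\<ge>0. \<forall>v\<ge>0. u + v = 1 \<longrightarrow> (\<lambda>i. u * \<alpha> i + v * \<beta> i) \<in> S)"

end

theory Submission
  imports Defs
begin

text \<open>
  Let \<open>X\<close> be the number of \<open>s\<close>-simplexes of the random complex \<open>Y\<close>; then \<open>dim Y \<ge> s\<close> means \<open>X \<noteq> 0\<close>. The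
  complex can be produced by choosing every simplex independently with the probability attached to its
  dimension and keeping those all of whose faces were chosen (\<open>complex_core_eq_iff\<close>). Therefore a
  given complex \<open>A\<close> is contained in \<open>Y\<close> with probability the product of \<open>p (dim \<sigma>)\<close> over the simplexes \<open>\<sigma>\<close> of \<open>A\<close>
  (\<open>sum_prob_fun_superset\<close>), and moments of \<open>X\<close> can be computed.

  A given simplex on \<open>k\<close> vertices is present with probability \<open>n powr (- A k)\<close>, where
  \<open>A k = (\<Sum>i\<le>r. (k choose (i + 1)) * \<alpha> i) = k * D r (k - 1) \<alpha>\<close>. So the expectation of \<open>X\<close> is of order
  \<open>n powr (k * (1 - D r s \<alpha>))\<close> with \<open>k = s + 1\<close>, and Markov's inequality settles \<open>D r s \<alpha> > 1\<close>.

  Two simplexes with \<open>j\<close> common vertices are positively correlated by the factor \<open>n powr A j\<close>, while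
  the proportion of such pairs is of order \<open>n powr (- j)\<close>. Hence the second moment of \<open>X\<close> exceeds the
  square of the first by a factor of at most \<open>1\<close> plus a constant times the sum of
  \<open>n powr (A j - j)\<close> over \<open>1 \<le> j \<le> k\<close>. As \<open>D r s \<alpha>\<close> is nondecreasing in \<open>s\<close> (\<open>D_mono\<close>), the condition
  \<open>D r s \<alpha> < 1\<close> makes all these exponents negative, and Cauchy--Schwarz shows that \<open>X \<noteq> 0\<close> has
  probability tending to one (\<open>prob_dim_ge_tendsto_1\<close>).

  That the domain is the whole area of parameters, for \<open>s < r\<close>, depends on the boundary cases. If
  \<open>D r s \<alpha> = 1\<close>, the probability of \<open>X \<noteq> 0\<close> tends neither to zero nor to one. Indeed, the exponents
  \<open>A j - j\<close> are still nonpositive, so the second moment bounds the probability from below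
  (\<open>prob_dim_ge_bounded_below\<close>), and the first moment bounds it away from one when \<open>s \<ge> 1\<close>, a direct
  computation doing the same when \<open>s = 0\<close> (\<open>prob_dim_ge_not_tendsto_1\<close>). Thus both thresholds are
  sharp, and for \<open>s < r\<close> the property \<open>dim Y = s\<close> a.a.s. is equivalent to \<open>D r s \<alpha> < 1 < D r (s + 1) \<alpha>\<close>.
\<close>

section \<open>Independent choice of simplexes\<close>

lemma finite_skeleton [simp]: "finite (skeleton n r)"
  by (rule finite_subset[of _ "Pow {1..n}"]) (auto simp: skeleton_def)

lemma finite_subcomplexes [simp]: "finite (subcomplexes n r)"
  by (rule finite_subset[of _ "Pow (skeleton n r)"]) (auto simp: subcomplexes_def)

lemma skeleton_simplex:
  assumes "\<sigma> \<in> skeleton n r"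
  shows "finite \<sigma>" "\<sigma> \<noteq> {}" "1 \<le> card \<sigma>" "card \<sigma> \<le> Suc r"
  using assms finite_subset[of \<sigma> "{1..n}"] by (auto simp: skeleton_def Suc_le_eq card_gt_0_iff)

lemma prod_power_card_eq:
  fixes x :: "nat \<Rightarrow> real"
  assumes "S \<subseteq> skeleton n r"
  shows "(\<Prod>i\<le>r. x i ^ card {\<sigma>\<in>S. card \<sigma> = Suc i}) = (\<Prod>\<sigma>\<in>S. x (card \<sigma> - 1))"
proof -
  have fin: "finite S"
    using assms finite_skeleton finite_subset by blast
  have dim: "1 \<le> card \<sigma> \<and> card \<sigma> \<le> Suc r" if "\<sigma> \<in> S" for \<sigma>
    using skeleton_simplex[of \<sigma> n r] that assms by blast
  have "(\<Prod>\<sigma>\<in>S. x (card \<sigma> - 1)) = (\<Prod>i\<le>r. \<Prod>\<sigma>\<in>{\<sigma>\<in>S. card \<sigma> - 1 = i}. x (card \<sigma> - 1))"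
    by (rule prod.group[symmetric]) (use fin dim in fastforce)+
  also have "\<dots> = (\<Prod>i\<le>r. x i ^ card {\<sigma>\<in>S. card \<sigma> = Suc i})"
  proof (rule prod.cong[OF refl])
    fix i
    have "{\<sigma>\<in>S. card \<sigma> - 1 = i} = {\<sigma>\<in>S. card \<sigma> = Suc i}"
      using dim by force
    then show "(\<Prod>\<sigma>\<in>{\<sigma>\<in>S. card \<sigma> - 1 = i}. x (card \<sigma> - 1)) = x i ^ card {\<sigma>\<in>S. card \<sigma> = Suc i}"
      by simp
  qed
  finally show ?thesis ..
qed

lemma prob_fun_eq_prod:
  assumes "Y \<in> subcomplexes n r"
  shows "prob_fun n r p Y =
    (\<Prod>\<sigma>\<in>Y. p (card \<sigma> - 1)) * (\<Prod>\<sigma>\<in>external_faces n Y \<inter> skeleton n r. 1 - p (card \<sigma> - 1))"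
proof -
  have "{\<sigma> \<in> external_faces n Y. card \<sigma> = Suc i} =
      {\<sigma> \<in> external_faces n Y \<inter> skeleton n r. card \<sigma> = Suc i}" if "i \<le> r" for i
    using that by (auto simp: external_faces_def skeleton_def)
  then have "(\<Prod>i\<le>r. (1 - p i) ^ e_num n i Y) =
      (\<Prod>i\<le>r. (1 - p i) ^ card {\<sigma> \<in> external_faces n Y \<inter> skeleton n r. card \<sigma> = Suc i})"
    unfolding e_num_def by (intro prod.cong) auto
  then show ?thesis
    using assms prod_power_card_eq[of Y n r p]
      prod_power_card_eq[of "external_faces n Y \<inter> skeleton n r" n r "\<lambda>i. 1 - p i"]
    unfolding prob_fun_def f_num_def subcomplexes_def by auto
qed

text \<open>
  Each \<open>\<sigma> \<in> S\<close> is put into \<open>Z\<close> independently with probability \<open>p \<sigma>\<close>; the sum is the probability that \<open>Z\<close>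
  contains \<open>A\<close> and misses \<open>B\<close>. It is the expansion of a product of binomials \<open>f \<sigma> + g \<sigma>\<close> over \<open>S\<close>,
  in which the summand of a forbidden choice is set to zero.
\<close>

lemma sum_random_subset_weights:
  fixes p :: "'a \<Rightarrow> real"
  assumes "finite S" "A \<subseteq> S" "B \<subseteq> S" "A \<inter> B = {}"
  shows "(\<Sum>Z | Z \<subseteq> S \<and> A \<subseteq> Z \<and> Z \<inter> B = {}. (\<Prod>\<sigma>\<in>Z. p \<sigma>) * (\<Prod>\<sigma>\<in>S - Z. 1 - p \<sigma>)) =
    (\<Prod>\<sigma>\<in>A. p \<sigma>) * (\<Prod>\<sigma>\<in>B. 1 - p \<sigma>)"
proof -
  define f where "f \<sigma> = (if \<sigma> \<in> B then 0 else p \<sigma>)" for \<sigma>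
  define g where "g \<sigma> = (if \<sigma> \<in> A then 0 else 1 - p \<sigma>)" for \<sigma>
  let ?C = "{Z. Z \<subseteq> S \<and> A \<subseteq> Z \<and> Z \<inter> B = {}}"
  have "(\<Sum>Z\<in>?C. (\<Prod>\<sigma>\<in>Z. p \<sigma>) * (\<Prod>\<sigma>\<in>S - Z. 1 - p \<sigma>)) =
      (\<Sum>Z\<in>?C. (\<Prod>\<sigma>\<in>Z. f \<sigma>) * (\<Prod>\<sigma>\<in>S - Z. g \<sigma>))"
    by (intro sum.cong arg_cong2[of _ _ _ _ "(*)"] prod.cong) (auto simp: f_def g_def)
  also have "\<dots> = (\<Sum>Z\<in>Pow S. (\<Prod>\<sigma>\<in>Z. f \<sigma>) * (\<Prod>\<sigma>\<in>S - Z. g \<sigma>))"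
  proof (rule sum.mono_neutral_left)
    show "\<forall>Z\<in>Pow S - ?C. (\<Prod>\<sigma>\<in>Z. f \<sigma>) * (\<Prod>\<sigma>\<in>S - Z. g \<sigma>) = 0"
    proof
      fix Z assume Z: "Z \<in> Pow S - ?C"
      then have fin: "finite Z" "finite (S - Z)"
        using assms(1) finite_subset by auto
      from Z consider \<sigma> where "\<sigma> \<in> A" "\<sigma> \<notin> Z" | \<sigma> where "\<sigma> \<in> Z" "\<sigma> \<in> B"
        by auto
      then have "(\<exists>\<sigma>\<in>S - Z. g \<sigma> = 0) \<or> (\<exists>\<sigma>\<in>Z. f \<sigma> = 0)"
        using assms(2) by cases (auto simp: f_def g_def)
      then show "(\<Prod>\<sigma>\<in>Z. f \<sigma>) * (\<Prod>\<sigma>\<in>S - Z. g \<sigma>) = 0"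
        using fin prod_zero[of Z f] prod_zero[of "S - Z" g] by auto
    qed
  qed (use assms(1) in auto)
  also have "\<dots> = (\<Prod>\<sigma>\<in>S. f \<sigma> + g \<sigma>)"
    using prod_add[OF assms(1), of f g] by simp
  also have "\<dots> = (\<Prod>\<sigma>\<in>A \<union> B. f \<sigma> + g \<sigma>)"
    by (rule prod.mono_neutral_right) (use assms in \<open>auto simp: f_def g_def\<close>)
  also have "\<dots> = (\<Prod>\<sigma>\<in>A. f \<sigma> + g \<sigma>) * (\<Prod>\<sigma>\<in>B. f \<sigma> + g \<sigma>)"
    by (rule prod.union_disjoint) (use assms finite_subset in auto)
  also have "\<dots> = (\<Prod>\<sigma>\<in>A. p \<sigma>) * (\<Prod>\<sigma>\<in>B. 1 - p \<sigma>)"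
    using assms(4) by (intro arg_cong2[of _ _ _ _ "(*)"] prod.cong) (auto simp: f_def g_def)
  finally show ?thesis .
qed

text \<open>
  This is the largest complex contained in \<open>Z\<close>. Choosing the simplexes of \<open>Z\<close> independently and
  passing to the core realises the random complex.
\<close>

definition complex_core :: "nat set set \<Rightarrow> nat set set" where
  "complex_core Z = {\<sigma> \<in> Z. \<forall>\<tau>. \<tau> \<noteq> {} \<and> \<tau> \<subseteq> \<sigma> \<longrightarrow> \<tau> \<in> Z}"

lemma complex_core_in_subcomplexes:
  assumes "Z \<subseteq> skeleton n r"
  shows "complex_core Z \<in> subcomplexes n r"
  using assms unfolding subcomplexes_def complex_core_def by blast

lemma subset_complex_core_iff:
  assumes "A \<in> subcomplexes n r"
  shows "A \<subseteq> complex_core Z \<longleftrightarrow> A \<subseteq> Z"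
  using assms unfolding subcomplexes_def complex_core_def by blast

text \<open>
  A simplex of \<open>Z\<close> with boundary in the core lies in the core itself, so \<open>Z\<close> meets no external face
  of its core. Conversely a minimal simplex of the core outside \<open>Y\<close> would be an external face of \<open>Y\<close>
  in \<open>Z\<close>. Thus the event that the core is \<open>Y\<close> prescribes the presence of the simplexes of \<open>Y\<close> and the
  absence of its external faces, and nothing else; this is where the weight \<open>prob_fun\<close> comes from.
\<close>

lemma complex_core_eq_iff:
  assumes Z: "Z \<subseteq> skeleton n r" and Y: "Y \<in> subcomplexes n r"
  shows "complex_core Z = Y \<longleftrightarrow> Y \<subseteq> Z \<and> Z \<inter> (external_faces n Y \<inter> skeleton n r) = {}"
proof
  assume eq: "complex_core Z = Y"
  have "\<sigma> \<in> Y" if "\<sigma> \<in> Z" "bdry \<sigma> \<subseteq> Y" for \<sigma>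
    using that unfolding eq[symmetric] complex_core_def bdry_def by blast
  then show "Y \<subseteq> Z \<and> Z \<inter> (external_faces n Y \<inter> skeleton n r) = {}"
    using eq by (auto simp: complex_core_def external_faces_def)
next
  assume R: "Y \<subseteq> Z \<and> Z \<inter> (external_faces n Y \<inter> skeleton n r) = {}"
  have "\<sigma> \<in> Y" if "\<sigma> \<in> complex_core Z" for \<sigma>
  proof -
    have "finite \<sigma>"
      using that Z skeleton_simplex(1) by (auto simp: complex_core_def)
    then show ?thesis
      using that
    proof (induction \<sigma> rule: finite_psubset_induct)
      case (psubset \<sigma>)
      then have \<sigma>: "\<sigma> \<in> Z" "\<sigma> \<in> skeleton n r"
        using Z by (auto simp: complex_core_def)
      have "bdry \<sigma> \<subseteq> Y"
      proof
        fix \<tau> assume "\<tau> \<in> bdry \<sigma>"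
        then have \<tau>: "\<tau> \<noteq> {}" "\<tau> \<subset> \<sigma>"
          by (auto simp: bdry_def)
        with psubset.prems have "\<tau> \<in> complex_core Z"
          by (auto simp: complex_core_def)
        with \<tau> show "\<tau> \<in> Y"
          by (intro psubset.IH)
      qed
      with \<sigma> R show ?case
        by (auto simp: external_faces_def skeleton_def)
    qed
  qed
  then show "complex_core Z = Y"
    using R subset_complex_core_iff[OF Y] by blast
qed

text \<open>
  A complex \<open>A\<close> lies in the core of \<open>Z\<close> as soon as it lies in \<open>Z\<close>, so in the independent model only
  the simplexes of \<open>A\<close> matter. The case \<open>A = {}\<close> says that the weights add up to one.
\<close>

lemma sum_prob_fun_superset:
  assumes A: "A \<in> subcomplexes n r"
  shows "(\<Sum>Y | Y \<in> subcomplexes n r \<and> A \<subseteq> Y. prob_fun n r p Y) = (\<Prod>\<sigma>\<in>A. p (card \<sigma> - 1))"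
proof -
  let ?S = "skeleton n r"
  define w where "w Z = (\<Prod>\<sigma>\<in>Z. p (card \<sigma> - 1)) * (\<Prod>\<sigma>\<in>?S - Z. 1 - p (card \<sigma> - 1))" for Z
  \<comment> \<open>the weight of a complex is the total weight of the sets \<open>Z\<close> with that core\<close>
  have fiber: "prob_fun n r p Y = (\<Sum>Z\<in>{Z \<in> {Z. Z \<subseteq> ?S \<and> A \<subseteq> Z}. complex_core Z = Y}. w Z)"
    if Y: "Y \<in> subcomplexes n r" "A \<subseteq> Y" for Y
  proof -
    have "{Z \<in> {Z. Z \<subseteq> ?S \<and> A \<subseteq> Z}. complex_core Z = Y} =
        {Z. Z \<subseteq> ?S \<and> Y \<subseteq> Z \<and> Z \<inter> (external_faces n Y \<inter> ?S) = {}}"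
      using complex_core_eq_iff[OF _ Y(1)] Y(2) by blast
    moreover have "Y \<subseteq> ?S" "Y \<inter> (external_faces n Y \<inter> ?S) = {}"
      using Y by (auto simp: subcomplexes_def external_faces_def)
    ultimately show ?thesis
      unfolding w_def prob_fun_eq_prod[OF Y(1)] by (simp add: sum_random_subset_weights)
  qed
  have "(\<Sum>Y | Y \<in> subcomplexes n r \<and> A \<subseteq> Y. prob_fun n r p Y) =
      (\<Sum>Y | Y \<in> subcomplexes n r \<and> A \<subseteq> Y.
        \<Sum>Z\<in>{Z \<in> {Z. Z \<subseteq> ?S \<and> A \<subseteq> Z}. complex_core Z = Y}. w Z)"
    by (intro sum.cong) (auto simp: fiber)
  also have "\<dots> = (\<Sum>Z | Z \<subseteq> ?S \<and> A \<subseteq> Z. w Z)"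
  proof (rule sum.group)
    show "complex_core ` {Z. Z \<subseteq> ?S \<and> A \<subseteq> Z} \<subseteq> {Y. Y \<in> subcomplexes n r \<and> A \<subseteq> Y}"
      using complex_core_in_subcomplexes subset_complex_core_iff[OF A] by blast
  qed auto
  also have "\<dots> = (\<Prod>\<sigma>\<in>A. p (card \<sigma> - 1))"
    using sum_random_subset_weights[of ?S A "{}" "\<lambda>\<sigma>. p (card \<sigma> - 1)"] A
    by (simp add: w_def subcomplexes_def)
  finally show ?thesis .
qed

section \<open>The probability space and the dimension\<close>

lemma prob_fun_nonneg:
  assumes "\<forall>i\<le>r. 0 \<le> p i \<and> p i \<le> 1"
  shows "0 \<le> prob_fun n r p Y"
  unfolding prob_fun_def using assms
  by (intro mult_nonneg_nonneg prod_nonneg zero_le_power ballI) auto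

lemma prob_random_complex:
  assumes "\<forall>i\<le>r. 0 \<le> p i \<and> p i \<le> 1"
  shows "\<P>(Y in random_complex n r p. Q Y) = (\<Sum>Y | Y \<in> subcomplexes n r \<and> Q Y. prob_fun n r p Y)"
proof -
  have "emeasure (random_complex n r p) {Y \<in> subcomplexes n r. Q Y} =
      ennreal (\<Sum>Y | Y \<in> subcomplexes n r \<and> Q Y. prob_fun n r p Y)"
    unfolding random_complex_def using prob_fun_nonneg[OF assms]
    by (subst emeasure_point_measure_finite) auto
  then show ?thesis
    by (simp add: measure_def random_complex_def space_point_measure sum_nonneg prob_fun_nonneg[OF assms])
qed

lemma empty_in_subcomplexes [simp]: "{} \<in> subcomplexes n r"
  by (simp add: subcomplexes_def)

lemma prob_space_random_complex:
  assumes "\<forall>i\<le>r. 0 \<le> p i \<and> p i \<le> 1"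
  shows "prob_space (random_complex n r p)"
  unfolding random_complex_def
proof (rule prob_space_point_measure)
  show "(\<Sum>Y\<in>subcomplexes n r. ennreal (prob_fun n r p Y)) = 1"
    using sum_prob_fun_superset[of "{}" n r p] prob_fun_nonneg[OF assms] by simp
qed (simp_all add: prob_fun_nonneg[OF assms])

lemma sets_random_complex: "sets (random_complex n r p) = Pow (subcomplexes n r)"
  by (simp add: random_complex_def sets_point_measure)

lemma space_random_complex: "space (random_complex n r p) = subcomplexes n r"
  by (simp add: random_complex_def space_point_measure)

text \<open>
  By closure under faces, a simplex of dimension at least \<open>s\<close> yields one of dimension exactly \<open>s\<close>. The
  dimension is thereby controlled by the counting variable \<open>f_num s\<close>.
\<close>

lemma complex_dim_ge_iff:
  assumes "Y \<in> subcomplexes n r"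
  shows "complex_dim Y \<ge> int s \<longleftrightarrow> f_num s Y \<noteq> 0"
proof -
  have fin: "finite Y"
    using assms finite_subset[of Y "skeleton n r"] by (auto simp: subcomplexes_def)
  have "complex_dim Y \<ge> int s \<longleftrightarrow> (\<exists>\<sigma>\<in>Y. Suc s \<le> card \<sigma>)"
  proof (cases "Y = {}")
    case False
    then have "complex_dim Y \<ge> int s \<longleftrightarrow> Suc s \<le> Max (card ` Y)"
      by (auto simp: complex_dim_def)
    then show ?thesis
      using False fin by (simp add: Max_ge_iff)
  qed (simp add: complex_dim_def)
  also have "\<dots> \<longleftrightarrow> (\<exists>\<sigma>\<in>Y. card \<sigma> = Suc s)"
  proof
    assume "\<exists>\<sigma>\<in>Y. Suc s \<le> card \<sigma>"
    then obtain \<sigma> \<tau> where "\<sigma> \<in> Y" "\<tau> \<subseteq> \<sigma>" "card \<tau> = Suc s"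
      by (meson obtain_subset_with_card_n)
    moreover from this have "\<tau> \<noteq> {}"
      by auto
    ultimately show "\<exists>\<sigma>\<in>Y. card \<sigma> = Suc s"
      using assms unfolding subcomplexes_def by blast
  qed force
  also have "\<dots> \<longleftrightarrow> f_num s Y \<noteq> 0"
    using fin by (auto simp: f_num_def)
  finally show ?thesis .
qed

section \<open>First and second moments of face numbers\<close>

definition simplices :: "nat \<Rightarrow> nat \<Rightarrow> nat set set" where
  "simplices n k = {\<sigma>. \<sigma> \<subseteq> {1..n} \<and> card \<sigma> = k}"

lemma finite_simplices [simp]: "finite (simplices n k)"
  by (rule finite_subset[of _ "Pow {1..n}"]) (auto simp: simplices_def)

lemma card_simplices: "card (simplices n k) = n choose k"
  unfolding simplices_def using n_subsets[of "{1..n}" k] by simp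

lemma finite_if_simplex: "\<sigma> \<in> simplices n k \<Longrightarrow> finite \<sigma>"
  by (auto simp: simplices_def intro: finite_subset)

lemma f_num_eq_sum:
  assumes "Y \<in> subcomplexes n r"
  shows "real (f_num s Y) = (\<Sum>\<sigma>\<in>simplices n (Suc s). of_bool (\<sigma> \<in> Y))"
proof -
  have "{\<sigma> \<in> Y. card \<sigma> = Suc s} = simplices n (Suc s) \<inter> {\<sigma>. \<sigma> \<in> Y}"
    using assms by (auto simp: subcomplexes_def simplices_def skeleton_def)
  then show ?thesis
    by (simp add: f_num_def)
qed

abbreviation faces :: "nat set \<Rightarrow> nat set set" where
  "faces \<sigma> \<equiv> Pow \<sigma> - {{}}"

lemma faces_subset_iff:
  assumes "Y \<in> subcomplexes n r" "\<sigma> \<noteq> {}"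
  shows "faces \<sigma> \<subseteq> Y \<longleftrightarrow> \<sigma> \<in> Y"
  using assms by (auto simp: subcomplexes_def)

lemma faces_in_subcomplexes:
  assumes "\<sigma> \<in> simplices n k" "k \<le> Suc r"
  shows "faces \<sigma> \<in> subcomplexes n r"
proof -
  have "card \<rho> \<le> Suc r" if "\<rho> \<subseteq> \<sigma>" for \<rho>
    using card_mono[OF finite_if_simplex[OF assms(1)] that] assms by (simp add: simplices_def)
  then show ?thesis
    using assms(1) by (auto simp: subcomplexes_def skeleton_def simplices_def)
qed

lemma Un_in_subcomplexes:
  assumes "A \<in> subcomplexes n r" "B \<in> subcomplexes n r"
  shows "A \<union> B \<in> subcomplexes n r"
proof -
  have "\<tau> \<in> A \<union> B" if "\<sigma> \<in> A \<union> B" "\<tau> \<noteq> {}" "\<tau> \<subseteq> \<sigma>" for \<sigma> \<tau>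
    using that assms by (elim UnE) (simp_all add: subcomplexes_def)
  then show ?thesis
    using assms by (simp add: subcomplexes_def)
qed

text \<open>
  For \<open>p i = n powr (- \<alpha> i)\<close> a given simplex on \<open>k \<le> r + 1\<close> vertices is present with
  probability \<open>n powr (- face_weight r \<alpha> k)\<close>, each of its faces contributing its own exponent.
\<close>

definition face_weight :: "nat \<Rightarrow> (nat \<Rightarrow> real) \<Rightarrow> nat \<Rightarrow> real" where
  "face_weight r \<alpha> k = (\<Sum>i\<le>r. real (k choose Suc i) * \<alpha> i)"

lemma sum_Pow_card:
  fixes g :: "nat \<Rightarrow> real"
  assumes "finite \<sigma>" "card \<sigma> \<le> m"
  shows "(\<Sum>\<rho>\<in>Pow \<sigma>. g (card \<rho>)) = (\<Sum>j\<le>m. real (card \<sigma> choose j) * g j)"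
proof -
  have card_le: "card \<rho> \<le> m" if "\<rho> \<subseteq> \<sigma>" for \<rho>
    using card_mono[OF assms(1) that] assms(2) by simp
  have "(\<Sum>\<rho>\<in>Pow \<sigma>. g (card \<rho>)) = (\<Sum>j\<le>m. \<Sum>\<rho>\<in>{\<rho>\<in>Pow \<sigma>. card \<rho> = j}. g (card \<rho>))"
    by (rule sum.group[symmetric]) (use assms(1) card_le in auto)
  also have "\<dots> = (\<Sum>j\<le>m. real (card \<sigma> choose j) * g j)"
    using n_subsets[OF assms(1)] by (intro sum.cong) (auto simp: Pow_def)
  finally show ?thesis .
qed

lemma face_weight_eq_sum:
  assumes "finite \<sigma>" "card \<sigma> \<le> Suc r"
  shows "(\<Sum>\<rho>\<in>faces \<sigma>. \<alpha> (card \<rho> - 1)) = face_weight r \<alpha> (card \<sigma>)"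
proof -
  define g where "g j = (if j = 0 then 0 else \<alpha> (j - 1))" for j
  have "(\<Sum>\<rho>\<in>faces \<sigma>. \<alpha> (card \<rho> - 1)) = (\<Sum>\<rho>\<in>faces \<sigma>. g (card \<rho>))"
    using assms(1) by (intro sum.cong) (auto simp: g_def card_eq_0_iff dest: finite_subset)
  also have "\<dots> = (\<Sum>\<rho>\<in>Pow \<sigma>. g (card \<rho>))"
    using assms(1) by (intro sum.mono_neutral_left) (auto simp: g_def)
  also have "\<dots> = (\<Sum>j\<le>Suc r. real (card \<sigma> choose j) * g j)"
    by (rule sum_Pow_card[OF assms])
  also have "\<dots> = face_weight r \<alpha> (card \<sigma>)"
    by (subst sum.atMost_Suc_shift) (simp add: g_def face_weight_def)
  finally show ?thesis .
qed

abbreviation powr_param :: "(nat \<Rightarrow> real) \<Rightarrow> nat \<Rightarrow> nat \<Rightarrow> real" where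
  "powr_param \<alpha> n \<equiv> (\<lambda>i. real n powr (- \<alpha> i))"

lemma powr_param_bounds:
  assumes "\<forall>i\<le>r. 0 \<le> \<alpha> i"
  shows "\<forall>i\<le>r. 0 \<le> powr_param \<alpha> n i \<and> powr_param \<alpha> n i \<le> 1"
proof (cases "n = 0")
  case False
  then show ?thesis
    using assms powr_mono[of "- \<alpha> _" 0 "real n"] by auto
qed simp

lemma prod_faces:
  assumes "finite \<sigma>" "card \<sigma> \<le> Suc r" "n > 0"
  shows "(\<Prod>\<rho>\<in>faces \<sigma>. powr_param \<alpha> n (card \<rho> - 1)) = real n powr (- face_weight r \<alpha> (card \<sigma>))"
proof -
  have "- face_weight r \<alpha> (card \<sigma>) = (\<Sum>\<rho>\<in>faces \<sigma>. - \<alpha> (card \<rho> - 1))"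
    unfolding face_weight_eq_sum[OF assms(1,2), symmetric] by (rule sum_negf[symmetric])
  moreover have "real n \<noteq> 0"
    using assms(3) by simp
  ultimately show ?thesis
    using powr_sum by metis
qed

text \<open>
  Both simplexes are present iff all their faces are, and the common faces, which are the faces of
  \<open>\<sigma> \<inter> \<tau>\<close>, are paid for only once.
\<close>

lemma prob_pair_of_simplices:
  assumes \<sigma>: "\<sigma> \<in> simplices n k" and \<tau>: "\<tau> \<in> simplices n k" and k: "0 < k" "k \<le> Suc r" and n: "n > 0"
  shows "(\<Sum>Y | Y \<in> subcomplexes n r \<and> \<sigma> \<in> Y \<and> \<tau> \<in> Y. prob_fun n r (powr_param \<alpha> n) Y) =
    real n powr (face_weight r \<alpha> (card (\<sigma> \<inter> \<tau>)) - 2 * face_weight r \<alpha> k)"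
proof -
  let ?h = "\<lambda>\<rho>::nat set. powr_param \<alpha> n (card \<rho> - 1)"
  have fin: "finite \<sigma>" "finite \<tau>" and card: "card \<sigma> = k" "card \<tau> = k"
    using \<sigma> \<tau> finite_if_simplex[OF \<sigma>] finite_if_simplex[OF \<tau>] by (auto simp: simplices_def)
  have card_Int: "card (\<sigma> \<inter> \<tau>) \<le> Suc r"
    using card_mono[OF fin(1), of "\<sigma> \<inter> \<tau>"] card k by simp
  have "{Y. Y \<in> subcomplexes n r \<and> \<sigma> \<in> Y \<and> \<tau> \<in> Y} =
      {Y. Y \<in> subcomplexes n r \<and> faces \<sigma> \<union> faces \<tau> \<subseteq> Y}"
  proof -
    have nonempty: "\<sigma> \<noteq> {}" "\<tau> \<noteq> {}"
      using card k by auto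
    show ?thesis
      by (simp only: Un_subset_iff faces_subset_iff[OF _ nonempty(1), of _ n r]
          faces_subset_iff[OF _ nonempty(2), of _ n r] cong: conj_cong)
  qed
  then have "(\<Sum>Y | Y \<in> subcomplexes n r \<and> \<sigma> \<in> Y \<and> \<tau> \<in> Y. prob_fun n r (powr_param \<alpha> n) Y) =
      prod ?h (faces \<sigma> \<union> faces \<tau>)"
    by (simp only: sum_prob_fun_superset[OF Un_in_subcomplexes[OF faces_in_subcomplexes[OF \<sigma> k(2)]
          faces_in_subcomplexes[OF \<tau> k(2)]]])
  moreover have "prod ?h (faces \<sigma> \<union> faces \<tau>) * prod ?h (faces (\<sigma> \<inter> \<tau>)) =
      prod ?h (faces \<sigma>) * prod ?h (faces \<tau>)"
  proof -
    have Int: "faces (\<sigma> \<inter> \<tau>) = faces \<sigma> \<inter> faces \<tau>"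
      by blast
    show ?thesis
      unfolding Int by (rule prod.union_inter) (use fin in auto)
  qed
  moreover have "prod ?h (faces \<sigma>) = real n powr (- face_weight r \<alpha> k)"
    using prod_faces[OF fin(1) _ n, of r \<alpha>] card k by (simp only:)
  moreover have "prod ?h (faces \<tau>) = real n powr (- face_weight r \<alpha> k)"
    using prod_faces[OF fin(2) _ n, of r \<alpha>] card k by (simp only:)
  moreover have "prod ?h (faces (\<sigma> \<inter> \<tau>)) = real n powr (- face_weight r \<alpha> (card (\<sigma> \<inter> \<tau>)))"
    using fin by (intro prod_faces card_Int n) auto
  ultimately have "(\<Sum>Y | Y \<in> subcomplexes n r \<and> \<sigma> \<in> Y \<and> \<tau> \<in> Y. prob_fun n r (powr_param \<alpha> n) Y) *
      real n powr (- face_weight r \<alpha> (card (\<sigma> \<inter> \<tau>))) =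
      real n powr (- face_weight r \<alpha> k) * real n powr (- face_weight r \<alpha> k)"
    by (simp only:)
  then show ?thesis
    using n by (simp add: powr_minus powr_diff powr_add[symmetric] field_simps)
qed

lemma prob_simplex:
  assumes \<sigma>: "\<sigma> \<in> simplices n k" and "0 < k" "k \<le> Suc r" "n > 0"
  shows "(\<Sum>Y | Y \<in> subcomplexes n r \<and> \<sigma> \<in> Y. prob_fun n r (powr_param \<alpha> n) Y) =
    real n powr (- face_weight r \<alpha> k)"
proof -
  have "card \<sigma> = k"
    using \<sigma> by (simp add: simplices_def)
  then show ?thesis
    using prob_pair_of_simplices[OF \<sigma> \<sigma> assms(2-4), of \<alpha>] by simp
qed

lemma expected_f_num:
  assumes s: "s \<le> r" and n: "n > 0"
  shows "(\<Sum>Y\<in>subcomplexes n r. prob_fun n r (powr_param \<alpha> n) Y * real (f_num s Y)) =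
    real (n choose Suc s) * real n powr (- face_weight r \<alpha> (Suc s))"
proof -
  let ?P = "prob_fun n r (powr_param \<alpha> n)" and ?S = "simplices n (Suc s)"
  have "(\<Sum>Y\<in>subcomplexes n r. ?P Y * real (f_num s Y)) =
      (\<Sum>Y\<in>subcomplexes n r. \<Sum>\<sigma>\<in>?S. if \<sigma> \<in> Y then ?P Y else 0)"
  proof (intro sum.cong refl)
    fix Y assume Y: "Y \<in> subcomplexes n r"
    show "?P Y * real (f_num s Y) = (\<Sum>\<sigma>\<in>?S. if \<sigma> \<in> Y then ?P Y else 0)"
      unfolding f_num_eq_sum[OF Y] sum_distrib_left by (intro sum.cong refl) auto
  qed
  also have "\<dots> = (\<Sum>\<sigma>\<in>?S. \<Sum>Y | Y \<in> subcomplexes n r \<and> \<sigma> \<in> Y. ?P Y)"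
    by (subst sum.swap) (simp add: sum.inter_filter[symmetric])
  also have "\<dots> = (\<Sum>\<sigma>\<in>?S. real n powr (- face_weight r \<alpha> (Suc s)))"
    using s n by (intro sum.cong refl prob_simplex) auto
  finally show ?thesis
    by (simp add: card_simplices)
qed

lemma expected_f_num_square:
  assumes s: "s \<le> r" and n: "n > 0"
  shows "(\<Sum>Y\<in>subcomplexes n r. prob_fun n r (powr_param \<alpha> n) Y * (real (f_num s Y))\<^sup>2) =
    (\<Sum>\<sigma>\<in>simplices n (Suc s). \<Sum>\<tau>\<in>simplices n (Suc s).
      real n powr (face_weight r \<alpha> (card (\<sigma> \<inter> \<tau>)) - 2 * face_weight r \<alpha> (Suc s)))"
proof -
  let ?P = "prob_fun n r (powr_param \<alpha> n)" and ?S = "simplices n (Suc s)"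
  have "(\<Sum>Y\<in>subcomplexes n r. ?P Y * (real (f_num s Y))\<^sup>2) =
      (\<Sum>Y\<in>subcomplexes n r. \<Sum>\<sigma>\<in>?S. \<Sum>\<tau>\<in>?S. if \<sigma> \<in> Y \<and> \<tau> \<in> Y then ?P Y else 0)"
  proof (intro sum.cong refl)
    fix Y assume Y: "Y \<in> subcomplexes n r"
    have square: "(real (f_num s Y))\<^sup>2 = (\<Sum>\<sigma>\<in>?S. \<Sum>\<tau>\<in>?S. of_bool (\<sigma> \<in> Y) * of_bool (\<tau> \<in> Y))"
      unfolding f_num_eq_sum[OF Y] power2_eq_square sum_product ..
    show "?P Y * (real (f_num s Y))\<^sup>2 = (\<Sum>\<sigma>\<in>?S. \<Sum>\<tau>\<in>?S. if \<sigma> \<in> Y \<and> \<tau> \<in> Y then ?P Y else 0)"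
      unfolding square sum_distrib_left by (intro sum.cong refl) simp
  qed
  also have "\<dots> = (\<Sum>\<sigma>\<in>?S. \<Sum>\<tau>\<in>?S. \<Sum>Y\<in>subcomplexes n r. if \<sigma> \<in> Y \<and> \<tau> \<in> Y then ?P Y else 0)"
    by (subst sum.swap, rule sum.cong[OF refl], rule sum.swap)
  also have "\<dots> = (\<Sum>\<sigma>\<in>?S. \<Sum>\<tau>\<in>?S. \<Sum>Y | Y \<in> subcomplexes n r \<and> \<sigma> \<in> Y \<and> \<tau> \<in> Y. ?P Y)"
    by (simp add: sum.inter_filter[symmetric])
  also have "\<dots> = (\<Sum>\<sigma>\<in>?S. \<Sum>\<tau>\<in>?S.
      real n powr (face_weight r \<alpha> (card (\<sigma> \<inter> \<tau>)) - 2 * face_weight r \<alpha> (Suc s)))"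
    using s n by (intro sum.cong refl prob_pair_of_simplices) auto
  finally show ?thesis .
qed

lemma card_simplices_meeting_le:
  assumes \<sigma>: "\<sigma> \<in> simplices n k" and J: "J \<subseteq> \<sigma>"
  shows "card {\<tau> \<in> simplices n k. \<sigma> \<inter> \<tau> = J} \<le> n choose (k - card J)"
proof -
  have "inj_on (\<lambda>\<tau>. \<tau> - J) {\<tau> \<in> simplices n k. \<sigma> \<inter> \<tau> = J}"
    by (rule inj_onI) blast
  moreover have "(\<lambda>\<tau>. \<tau> - J) ` {\<tau> \<in> simplices n k. \<sigma> \<inter> \<tau> = J} \<subseteq> simplices n (k - card J)"
  proof (rule image_subsetI)
    fix \<tau> assume "\<tau> \<in> {\<tau> \<in> simplices n k. \<sigma> \<inter> \<tau> = J}"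
    then have \<tau>: "\<tau> \<subseteq> {1..n}" "card \<tau> = k" "J \<subseteq> \<tau>"
      by (auto simp: simplices_def)
    moreover have "finite J"
      using finite_subset[OF J finite_if_simplex[OF \<sigma>]] .
    ultimately show "\<tau> - J \<in> simplices n (k - card J)"
      by (auto simp: simplices_def card_Diff_subset)
  qed
  ultimately show ?thesis
    using card_inj_on_le[OF _ _ finite_simplices] card_simplices by metis
qed

text \<open>
  The simplexes \<open>\<tau>\<close> are classified by their intersection \<open>J\<close> with \<open>\<sigma>\<close>; given \<open>J\<close>, the remaining
  \<open>k - card J\<close> vertices of \<open>\<tau>\<close> can be chosen in at most \<open>n choose (k - card J)\<close> ways.
\<close>

lemma sum_overlap_le:
  fixes g :: "nat \<Rightarrow> real"
  assumes \<sigma>: "\<sigma> \<in> simplices n k" and g: "\<And>j. 0 \<le> g j"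
  shows "(\<Sum>\<tau>\<in>simplices n k. g (card (\<sigma> \<inter> \<tau>))) \<le>
    (\<Sum>j\<le>k. real (k choose j) * (real (n choose (k - j)) * g j))"
proof -
  have fin: "finite \<sigma>" and card: "card \<sigma> = k"
    using \<sigma> finite_if_simplex[OF \<sigma>] by (auto simp: simplices_def)
  have "(\<Sum>\<tau>\<in>simplices n k. g (card (\<sigma> \<inter> \<tau>))) =
      (\<Sum>J\<in>Pow \<sigma>. \<Sum>\<tau>\<in>{\<tau> \<in> simplices n k. \<sigma> \<inter> \<tau> = J}. g (card (\<sigma> \<inter> \<tau>)))"
    by (rule sum.group[symmetric]) (use fin in auto)
  also have "\<dots> = (\<Sum>J\<in>Pow \<sigma>. real (card {\<tau> \<in> simplices n k. \<sigma> \<inter> \<tau> = J}) * g (card J))"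
    by (intro sum.cong refl) simp
  also have "\<dots> \<le> (\<Sum>J\<in>Pow \<sigma>. real (n choose (k - card J)) * g (card J))"
    by (intro sum_mono mult_right_mono g) (use card_simplices_meeting_le[OF \<sigma>] in auto)
  also have "\<dots> = (\<Sum>j\<le>k. real (k choose j) * (real (n choose (k - j)) * g j))"
    using sum_Pow_card[OF fin, of k "\<lambda>j. real (n choose (k - j)) * g j"] card by simp
  finally show ?thesis .
qed

lemma binomial_ratio_le:
  assumes "j \<le> k" "0 < k" "k \<le> n"
  shows "real (n choose (k - j)) \<le> real k ^ k * real (n choose k) * real n powr (- real j)"
proof -
  have n: "real n > 0"
    using assms by simp
  have "real (n choose (k - j)) \<le> real (n ^ (k - j))"
    using assms by (intro of_nat_mono binomial_le_pow) simp
  also have "\<dots> = real n ^ k * real n powr (- real j)"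
  proof -
    have "real n ^ k = real n ^ (k - j) * real n ^ j"
      using assms by (simp add: power_add[symmetric])
    then show ?thesis
      using n by (simp add: powr_minus powr_realpow)
  qed
  also have "real n ^ k \<le> real k ^ k * real (n choose k)"
    using binomial_ge_n_over_k_pow_k[of k n, where 'a=real] assms by (simp add: field_simps)
  finally show ?thesis
    by (simp add: mult_right_mono)
qed

text \<open>
  Cauchy--Schwarz applied to the product of \<open>X\<close> and the indicator of \<open>X \<noteq> 0\<close>, with weights \<open>w\<close>: the probability that \<open>X\<close> is nonzero is at least
  the squared first moment divided by the second moment.
\<close>

lemma second_moment_bound:
  fixes w X :: "'a \<Rightarrow> real"
  assumes "finite S" "\<And>x. x \<in> S \<Longrightarrow> 0 \<le> w x"
  shows "(\<Sum>x\<in>S. w x * X x)\<^sup>2 \<le> (\<Sum>x | x \<in> S \<and> X x \<noteq> 0. w x) * (\<Sum>x\<in>S. w x * (X x)\<^sup>2)"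
proof -
  have "(\<Sum>x\<in>S. w x * X x) = (\<Sum>x\<in>S. (sqrt (w x) * of_bool (X x \<noteq> 0)) * (sqrt (w x) * X x))"
  proof (intro sum.cong refl)
    fix x assume "x \<in> S"
    then have "sqrt (w x) * sqrt (w x) = w x"
      using assms(2) by simp
    then show "w x * X x = (sqrt (w x) * of_bool (X x \<noteq> 0)) * (sqrt (w x) * X x)"
      by (cases "X x = 0") (simp_all add: mult.assoc[symmetric])
  qed
  then have "(\<Sum>x\<in>S. w x * X x)\<^sup>2 \<le>
      (\<Sum>x\<in>S. (sqrt (w x) * of_bool (X x \<noteq> 0))\<^sup>2) * (\<Sum>x\<in>S. (sqrt (w x) * X x)\<^sup>2)"
    by (simp only: Cauchy_Schwarz_ineq_sum)
  also have "(\<Sum>x\<in>S. (sqrt (w x) * X x)\<^sup>2) = (\<Sum>x\<in>S. w x * (X x)\<^sup>2)"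
    using assms(2) by (intro sum.cong) (auto simp: power_mult_distrib)
  also have "(\<Sum>x\<in>S. (sqrt (w x) * of_bool (X x \<noteq> 0))\<^sup>2) = (\<Sum>x\<in>S. if X x \<noteq> 0 then w x else 0)"
    using assms(2) by (intro sum.cong) (auto simp: power_mult_distrib)
  also have "\<dots> = (\<Sum>x | x \<in> S \<and> X x \<noteq> 0. w x)"
    using assms(1) by (simp only: sum.inter_filter)
  finally show ?thesis .
qed

section \<open>Comparison of the moments\<close>

text \<open>
  An upper bound for the quotient of the second moment of the number of simplexes on \<open>k\<close> vertices by
  the square of the first. The leading \<open>1\<close> comes from disjoint pairs, the term for \<open>j\<close> from pairs with
  \<open>j\<close> common vertices.
\<close>

definition overlap_bound :: "nat \<Rightarrow> (nat \<Rightarrow> real) \<Rightarrow> nat \<Rightarrow> nat \<Rightarrow> real" where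
  "overlap_bound r \<alpha> k n =
    1 + (\<Sum>j=1..k. real (k choose j) * real k ^ k * real n powr (face_weight r \<alpha> j - real j))"

lemma overlap_bound_pos: "0 < overlap_bound r \<alpha> k n"
  unfolding overlap_bound_def by (intro add_pos_nonneg sum_nonneg) auto

text \<open>
  Pairs with \<open>j\<close> common vertices are rarer than all pairs by a factor of order \<open>n powr (- j)\<close>, but more likely
  than disjoint ones by the factor \<open>n powr face_weight r \<alpha> j\<close>.
\<close>

lemma expected_f_num_square_le:
  assumes s: "s \<le> r" and n: "Suc s \<le> n"
  shows "(\<Sum>Y\<in>subcomplexes n r. prob_fun n r (powr_param \<alpha> n) Y * (real (f_num s Y))\<^sup>2) \<le>
    (\<Sum>Y\<in>subcomplexes n r. prob_fun n r (powr_param \<alpha> n) Y * real (f_num s Y))\<^sup>2 *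
    overlap_bound r \<alpha> (Suc s) n"
proof -
  define k where "k = Suc s"
  define N where "N = real (n choose k)"
  define A where "A = face_weight r \<alpha>"
  have n0: "n > 0" and kn: "0 < k" "k \<le> n"
    using n by (auto simp: k_def)
  have A0: "A 0 = 0"
    by (simp add: A_def face_weight_def)
  have overlap: "(\<Sum>\<tau>\<in>simplices n k. real n powr (A (card (\<sigma> \<inter> \<tau>)) - 2 * A k)) \<le>
      N * real n powr (- 2 * A k) * overlap_bound r \<alpha> k n" if \<sigma>: "\<sigma> \<in> simplices n k" for \<sigma>
  proof -
    let ?c = "\<lambda>j. real (k choose j) * (real (n choose (k - j)) * real n powr A j)"
    \<comment> \<open>\<open>?c j\<close> bounds the contribution of the \<open>\<tau>\<close> sharing \<open>j\<close> vertices with \<open>\<sigma>\<close>; \<open>?c 0\<close> yields the leading \<open>1\<close> of \<open>overlap_bound\<close>\<close>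
    have "(\<Sum>\<tau>\<in>simplices n k. real n powr A (card (\<sigma> \<inter> \<tau>))) \<le> (\<Sum>j\<le>k. ?c j)"
      by (rule sum_overlap_le[OF \<sigma>]) simp
    also have "\<dots> = ?c 0 + (\<Sum>j=1..k. ?c j)"
      by (simp add: atMost_atLeast0 sum.atLeast_Suc_atMost)
    also have "?c 0 = N"
      using n0 by (simp add: A0 N_def)
    also have "(\<Sum>j=1..k. ?c j) \<le> (\<Sum>j=1..k. N * (real (k choose j) * real k ^ k * real n powr (A j - real j)))"
    proof (rule sum_mono)
      fix j assume "j \<in> {1..k}"
      then have "real (n choose (k - j)) * real n powr A j \<le>
          real k ^ k * N * real n powr (- real j) * real n powr A j"
        unfolding N_def using kn by (intro mult_right_mono binomial_ratio_le) auto
      also have "\<dots> = real k ^ k * N * real n powr (A j - real j)"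
        by (simp add: powr_add[symmetric])
      finally have "?c j \<le> real (k choose j) * (real k ^ k * N * real n powr (A j - real j))"
        by (intro mult_left_mono) auto
      then show "?c j \<le> N * (real (k choose j) * real k ^ k * real n powr (A j - real j))"
        by (simp only: mult_ac)
    qed
    also have "N + (\<Sum>j=1..k. N * (real (k choose j) * real k ^ k * real n powr (A j - real j))) =
        N * overlap_bound r \<alpha> k n"
      by (simp add: overlap_bound_def A_def distrib_left sum_distrib_left)
    finally have "(\<Sum>\<tau>\<in>simplices n k. real n powr A (card (\<sigma> \<inter> \<tau>))) \<le> N * overlap_bound r \<alpha> k n"
      by simp
    then have "real n powr (- 2 * A k) * (\<Sum>\<tau>\<in>simplices n k. real n powr A (card (\<sigma> \<inter> \<tau>))) \<le>
        real n powr (- 2 * A k) * (N * overlap_bound r \<alpha> k n)"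
      by (intro mult_left_mono) auto
    also have "real n powr (- 2 * A k) * (\<Sum>\<tau>\<in>simplices n k. real n powr A (card (\<sigma> \<inter> \<tau>))) =
        (\<Sum>\<tau>\<in>simplices n k. real n powr (A (card (\<sigma> \<inter> \<tau>)) - 2 * A k))"
      by (simp add: sum_distrib_left powr_add[symmetric])
    finally show ?thesis
      by (simp only: mult_ac)
  qed
  have "(\<Sum>Y\<in>subcomplexes n r. prob_fun n r (powr_param \<alpha> n) Y * (real (f_num s Y))\<^sup>2) =
      (\<Sum>\<sigma>\<in>simplices n k. \<Sum>\<tau>\<in>simplices n k. real n powr (A (card (\<sigma> \<inter> \<tau>)) - 2 * A k))"
    unfolding k_def A_def by (rule expected_f_num_square[OF s n0])
  also have "\<dots> \<le> (\<Sum>\<sigma>\<in>simplices n k. N * real n powr (- 2 * A k) * overlap_bound r \<alpha> k n)"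
    by (rule sum_mono) (rule overlap)
  also have "\<dots> = (N * real n powr (- A k))\<^sup>2 * overlap_bound r \<alpha> k n"
    by (simp add: card_simplices N_def[symmetric] power2_eq_square powr_add[symmetric])
  finally show ?thesis
    unfolding expected_f_num[OF s n0] by (simp only: N_def A_def k_def)
qed

abbreviation prob_dim_ge :: "nat \<Rightarrow> (nat \<Rightarrow> real) \<Rightarrow> nat \<Rightarrow> nat \<Rightarrow> real" where
  "prob_dim_ge r \<alpha> s n \<equiv> \<P>(Y in random_complex n r (powr_param \<alpha> n). int s \<le> complex_dim Y)"

lemma prob_dim_ge_eq:
  assumes "\<forall>i\<le>r. 0 \<le> \<alpha> i"
  shows "prob_dim_ge r \<alpha> s n =
    (\<Sum>Y | Y \<in> subcomplexes n r \<and> real (f_num s Y) \<noteq> 0. prob_fun n r (powr_param \<alpha> n) Y)"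
  unfolding prob_random_complex[OF powr_param_bounds[OF assms]]
  by (rule sum.cong) (use complex_dim_ge_iff in auto)

lemma prob_dim_ge_lower:
  assumes \<alpha>: "\<forall>i\<le>r. 0 \<le> \<alpha> i" and s: "s \<le> r" and n: "Suc s \<le> n"
  shows "1 / overlap_bound r \<alpha> (Suc s) n \<le> prob_dim_ge r \<alpha> s n"
proof -
  define E where "E = (\<Sum>Y\<in>subcomplexes n r. prob_fun n r (powr_param \<alpha> n) Y * real (f_num s Y))"
  let ?P = "prob_dim_ge r \<alpha> s n" and ?R = "overlap_bound r \<alpha> (Suc s) n"
  have "E\<^sup>2 \<le> ?P * (\<Sum>Y\<in>subcomplexes n r. prob_fun n r (powr_param \<alpha> n) Y * (real (f_num s Y))\<^sup>2)"
    unfolding E_def prob_dim_ge_eq[OF \<alpha>]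
    by (rule second_moment_bound) (simp_all add: prob_fun_nonneg[OF powr_param_bounds[OF \<alpha>]])
  also have "\<dots> \<le> ?P * (E\<^sup>2 * ?R)"
    unfolding E_def by (intro mult_left_mono expected_f_num_square_le s n) simp
  finally have "E\<^sup>2 * 1 \<le> E\<^sup>2 * (?P * ?R)"
    by (simp only: mult_ac mult_1_right)
  moreover have "E > 0"
    using s n unfolding E_def by (subst expected_f_num) auto
  ultimately have "1 \<le> ?P * ?R"
    by (subst (asm) mult_le_cancel_left_pos) auto
  then show ?thesis
    using overlap_bound_pos[of r \<alpha> "Suc s" n] by (simp only: pos_divide_le_eq)
qed

text \<open>
  Markov's inequality: the probability that the count is nonzero is at most its expectation.
\<close>

lemma prob_dim_ge_upper:
  assumes \<alpha>: "\<forall>i\<le>r. 0 \<le> \<alpha> i" and s: "s \<le> r" and n: "n > 0"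
  shows "prob_dim_ge r \<alpha> s n \<le> real (n choose Suc s) * real n powr (- face_weight r \<alpha> (Suc s))"
proof -
  let ?p = "prob_fun n r (powr_param \<alpha> n)"
  have "prob_dim_ge r \<alpha> s n \<le> (\<Sum>Y | Y \<in> subcomplexes n r \<and> real (f_num s Y) \<noteq> 0. ?p Y * real (f_num s Y))"
    unfolding prob_dim_ge_eq[OF \<alpha>]
  proof (rule sum_mono)
    fix Y assume "Y \<in> {Y. Y \<in> subcomplexes n r \<and> real (f_num s Y) \<noteq> 0}"
    then have "1 \<le> real (f_num s Y)"
      by simp
    then show "?p Y \<le> ?p Y * real (f_num s Y)"
      using mult_left_mono[of 1 "real (f_num s Y)" "?p Y"] prob_fun_nonneg[OF powr_param_bounds[OF \<alpha>]]
      by simp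
  qed
  also have "\<dots> = (\<Sum>Y\<in>subcomplexes n r. ?p Y * real (f_num s Y))"
    by (rule sum.mono_neutral_left) auto
  finally show ?thesis
    by (simp only: expected_f_num[OF s n])
qed

section \<open>Behaviour below, at and above the threshold\<close>

lemma D_eq_face_weight: "D r s \<alpha> = face_weight r \<alpha> (Suc s) / real (Suc s)"
  unfolding D_def face_weight_def sum_divide_distrib by (rule sum.cong) simp_all

lemma binomial_Suc_div: "real (Suc m choose Suc i) / real (Suc m) = real (m choose i) / real (Suc i)"
proof -
  have "real (Suc m choose Suc i) * real (Suc i) = real (Suc m) * real (m choose i)"
    using Suc_times_binomial_eq[of m i] by (metis of_nat_mult)
  then show ?thesis
    by (simp add: field_simps)
qed

text \<open>
  The coefficient of \<open>\<alpha> i\<close> in \<open>D r m \<alpha>\<close> equals \<open>(m choose i) / (i + 1)\<close>, which grows with \<open>m\<close>. Hence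
  an upper bound on \<open>D r s \<alpha>\<close> holds for all \<open>D r m \<alpha>\<close> with \<open>m \<le> s\<close>, and so controls the overlaps of
  every size in the second moment.
\<close>

lemma D_mono:
  assumes \<alpha>: "\<forall>i\<le>r. 0 \<le> \<alpha> i" and "m \<le> s"
  shows "D r m \<alpha> \<le> D r s \<alpha>"
  unfolding D_def binomial_Suc_div using assms
  by (intro sum_mono mult_right_mono divide_right_mono of_nat_mono binomial_right_mono) auto

lemma face_weight_conv_D: "0 < j \<Longrightarrow> face_weight r \<alpha> j = real j * D r (j - 1) \<alpha>"
  by (simp add: D_eq_face_weight)

lemma face_weight_less:
  assumes "\<forall>i\<le>r. 0 \<le> \<alpha> i" "D r s \<alpha> < 1" "1 \<le> j" "j \<le> Suc s"
  shows "face_weight r \<alpha> j < real j"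
proof -
  have "D r (j - 1) \<alpha> \<le> D r s \<alpha>"
    using assms by (intro D_mono) auto
  then show ?thesis
    using assms by (simp add: face_weight_conv_D)
qed

lemma face_weight_le:
  assumes "\<forall>i\<le>r. 0 \<le> \<alpha> i" "D r s \<alpha> \<le> 1" "1 \<le> j" "j \<le> Suc s"
  shows "face_weight r \<alpha> j \<le> real j"
proof -
  have "D r (j - 1) \<alpha> \<le> D r s \<alpha>"
    using assms by (intro D_mono) auto
  then show ?thesis
    using assms by (simp add: face_weight_conv_D)
qed

lemma prob_dim_ge_le_1:
  assumes "\<forall>i\<le>r. 0 \<le> \<alpha> i"
  shows "prob_dim_ge r \<alpha> s n \<le> 1"
  using prob_space.prob_le_1[OF prob_space_random_complex[OF powr_param_bounds[OF assms]]] .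

lemma prob_dim_ge_tendsto_1:
  assumes \<alpha>: "\<forall>i\<le>r. 0 \<le> \<alpha> i" and s: "s \<le> r" and D: "D r s \<alpha> < 1"
  shows "prob_dim_ge r \<alpha> s \<longlonglongrightarrow> 1"
proof -
  have "overlap_bound r \<alpha> (Suc s) \<longlonglongrightarrow>
      1 + (\<Sum>j=1..Suc s. real (Suc s choose j) * real (Suc s) ^ Suc s * 0)"
    unfolding overlap_bound_def
  proof (intro tendsto_intros)
    fix j assume "j \<in> {1..Suc s}"
    then have "face_weight r \<alpha> j - real j < 0"
      using face_weight_less[OF \<alpha> D, of j] by simp
    then show "(\<lambda>n. real n powr (face_weight r \<alpha> j - real j)) \<longlonglongrightarrow> 0"
      by (rule tendsto_neg_powr) (rule filterlim_real_sequentially)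
  qed
  then have lim: "(\<lambda>n. 1 / overlap_bound r \<alpha> (Suc s) n) \<longlonglongrightarrow> 1"
    using tendsto_divide[OF tendsto_const[of 1], of "overlap_bound r \<alpha> (Suc s)" 1 sequentially] by simp
  show ?thesis
  proof (rule tendsto_sandwich[OF _ _ lim tendsto_const[of 1]])
    show "\<forall>\<^sub>F n in sequentially. 1 / overlap_bound r \<alpha> (Suc s) n \<le> prob_dim_ge r \<alpha> s n"
      using eventually_ge_at_top[of "Suc s"] by eventually_elim (rule prob_dim_ge_lower[OF \<alpha> s])
    show "\<forall>\<^sub>F n in sequentially. prob_dim_ge r \<alpha> s n \<le> 1"
      by (simp add: prob_dim_ge_le_1[OF \<alpha>])
  qed
qed

text \<open>
  On the threshold \<open>D r s \<alpha> = 1\<close> the second moment stays within a constant factor of the squared first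
  moment, which keeps the probability away from zero.
\<close>

lemma prob_dim_ge_bounded_below:
  assumes \<alpha>: "\<forall>i\<le>r. 0 \<le> \<alpha> i" and s: "s \<le> r" and D: "D r s \<alpha> \<le> 1"
  shows "\<exists>c>0. \<forall>\<^sub>F n in sequentially. c \<le> prob_dim_ge r \<alpha> s n"
proof -
  define C where "C = 1 + (\<Sum>j=1..Suc s. real (Suc s choose j) * real (Suc s) ^ Suc s * 1)"
  have C: "C > 0"
    unfolding C_def by (intro add_pos_nonneg sum_nonneg) auto
  have "1 / C \<le> prob_dim_ge r \<alpha> s n" if n: "Suc s \<le> n" for n
  proof -
    have "overlap_bound r \<alpha> (Suc s) n \<le> C"
      unfolding overlap_bound_def C_def
    proof (intro add_left_mono sum_mono mult_left_mono)
      fix j assume "j \<in> {1..Suc s}"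
      then show "real n powr (face_weight r \<alpha> j - real j) \<le> 1"
        using n face_weight_le[OF \<alpha> D, of j] powr_mono[of "face_weight r \<alpha> j - real j" 0 "real n"] by simp
    qed simp
    then have "1 / C \<le> 1 / overlap_bound r \<alpha> (Suc s) n"
      using overlap_bound_pos[of r \<alpha> "Suc s" n] C by (intro divide_left_mono mult_pos_pos) auto
    also have "\<dots> \<le> prob_dim_ge r \<alpha> s n"
      by (rule prob_dim_ge_lower[OF \<alpha> s n])
    finally show ?thesis .
  qed
  then have "\<forall>\<^sub>F n in sequentially. 1 / C \<le> prob_dim_ge r \<alpha> s n"
    by (rule eventually_sequentiallyI)
  then show ?thesis
    using C by (intro exI[of _ "1 / C"]) simp
qed

lemma prob_dim_ge_tendsto_0:
  assumes \<alpha>: "\<forall>i\<le>r. 0 \<le> \<alpha> i" and s: "s \<le> r" and D: "D r s \<alpha> > 1"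
  shows "prob_dim_ge r \<alpha> s \<longlonglongrightarrow> 0"
proof (rule tendsto_sandwich[OF _ _ tendsto_const[of 0]])
  let ?A = "face_weight r \<alpha> (Suc s)"
  show "\<forall>\<^sub>F n in sequentially. prob_dim_ge r \<alpha> s n \<le> real n powr (real (Suc s) - ?A)"
    using eventually_ge_at_top[of "Suc s"]
  proof eventually_elim
    case (elim n)
    have "prob_dim_ge r \<alpha> s n \<le> real (n choose Suc s) * real n powr (- ?A)"
      using elim by (intro prob_dim_ge_upper[OF \<alpha> s]) simp
    also have "\<dots> \<le> real (n ^ Suc s) * real n powr (- ?A)"
      using elim by (intro mult_right_mono of_nat_mono binomial_le_pow) auto
    also have "\<dots> = real n powr (real (Suc s) - ?A)"
      using elim powr_realpow[of "real n" "Suc s"] powr_add[of "real n" "real (Suc s)" "- ?A"] by simp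
    finally show ?case .
  qed
  have "real (Suc s) - ?A < 0"
    using D by (simp add: D_eq_face_weight less_divide_eq)
  then show "(\<lambda>n. real n powr (real (Suc s) - ?A)) \<longlonglongrightarrow> 0"
    by (rule tendsto_neg_powr) (rule filterlim_real_sequentially)
qed simp

lemma prob_complement_dim_ge:
  assumes "\<forall>i\<le>r. 0 \<le> \<alpha> i"
  shows "\<P>(Y in random_complex n r (powr_param \<alpha> n). complex_dim Y < int s) = 1 - prob_dim_ge r \<alpha> s n"
  using prob_space.prob_neg[OF prob_space_random_complex[OF powr_param_bounds[OF assms]],
      where P = "\<lambda>Y. int s \<le> complex_dim Y"]
  by (simp add: sets_random_complex space_random_complex not_le)

lemma prob_dim_eq:
  assumes \<alpha>: "\<forall>i\<le>r. 0 \<le> \<alpha> i"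
  shows "\<P>(Y in random_complex n r (powr_param \<alpha> n). complex_dim Y = int s) =
    prob_dim_ge r \<alpha> s n - prob_dim_ge r \<alpha> (Suc s) n"
proof -
  let ?p = "prob_fun n r (powr_param \<alpha> n)"
  have "(\<Sum>Y | Y \<in> subcomplexes n r \<and> int s \<le> complex_dim Y. ?p Y) =
     (\<Sum>Y | Y \<in> subcomplexes n r \<and> complex_dim Y = int s. ?p Y) +
     (\<Sum>Y | Y \<in> subcomplexes n r \<and> int (Suc s) \<le> complex_dim Y. ?p Y)"
    by (subst sum.union_disjoint[symmetric]) (auto intro: sum.cong)
  then show ?thesis
    unfolding prob_random_complex[OF powr_param_bounds[OF \<alpha>]] by simp
qed

text \<open>
  Dimension \<open>-1\<close> means that all \<open>n\<close> vertices, the external faces of the empty complex, are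
  absent.
\<close>

lemma prob_dim_ge_0:
  assumes \<alpha>: "\<forall>i\<le>r. 0 \<le> \<alpha> i"
  shows "prob_dim_ge r \<alpha> 0 n = 1 - (1 - real n powr (- \<alpha> 0)) ^ n"
proof -
  have only_empty: "{Y. Y \<in> subcomplexes n r \<and> complex_dim Y < int 0} = {{}}"
  proof -
    have "0 \<le> complex_dim Y" if Y: "Y \<in> subcomplexes n r" "Y \<noteq> {}" for Y
    proof -
      obtain \<sigma> where \<sigma>: "\<sigma> \<in> Y" "\<sigma> \<in> skeleton n r"
        using Y by (auto simp: subcomplexes_def)
      have "1 \<le> card \<sigma>" "card \<sigma> \<le> Max (card ` Y)"
        using \<sigma> skeleton_simplex(3) Y(1) finite_subset[of Y "skeleton n r"]
        by (auto simp: subcomplexes_def)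
      then show ?thesis
        using Y(2) by (simp add: complex_dim_def)
    qed
    then show ?thesis
      by (force simp: complex_dim_def)
  qed
  have external: "external_faces n {} \<inter> skeleton n r = simplices n 1"
  proof -
    have "bdry \<sigma> = {} \<longleftrightarrow> card \<sigma> = 1" if "finite \<sigma>" "\<sigma> \<noteq> {}" for \<sigma>
    proof
      assume "bdry \<sigma> = {}"
      moreover obtain v where "v \<in> \<sigma>"
        using \<open>\<sigma> \<noteq> {}\<close> by blast
      ultimately have "\<sigma> = {v}"
        unfolding bdry_def by blast
      then show "card \<sigma> = 1"
        by simp
    qed (auto simp: bdry_def card_1_singleton_iff)
    then have "\<sigma> \<in> external_faces n {} \<inter> skeleton n r \<longleftrightarrow> \<sigma> \<in> simplices n 1" if "\<sigma> \<in> skeleton n r" for \<sigma>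
      using that skeleton_simplex(1,2)[OF that]
      by (simp add: external_faces_def skeleton_def simplices_def)
    moreover have "simplices n 1 \<subseteq> skeleton n r"
      by (auto simp: simplices_def skeleton_def)
    ultimately show ?thesis
      by blast
  qed
  have "1 - prob_dim_ge r \<alpha> 0 n = \<P>(Y in random_complex n r (powr_param \<alpha> n). complex_dim Y < int 0)"
    by (rule prob_complement_dim_ge[OF \<alpha>, symmetric])
  also have "\<dots> = prob_fun n r (powr_param \<alpha> n) {}"
    unfolding prob_random_complex[OF powr_param_bounds[OF \<alpha>]] only_empty by simp
  also have "\<dots> = (\<Prod>\<sigma>\<in>simplices n 1. 1 - powr_param \<alpha> n (card \<sigma> - 1))"
    unfolding prob_fun_eq_prod[OF empty_in_subcomplexes] external by simp
  also have "\<dots> = (\<Prod>\<sigma>\<in>simplices n 1. 1 - real n powr (- \<alpha> 0))"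
    by (intro prod.cong) (auto simp: simplices_def)
  finally show ?thesis
    by (simp add: card_simplices)
qed

text \<open>
  At and above the threshold the expected number of \<open>s\<close>-simplexes is at most \<open>1 / fact (s + 1)\<close>,
  so for \<open>s \<ge> 1\<close> Markov's inequality bounds the probability by one half. For \<open>s = 0\<close> that bound is
  the trivial \<open>1\<close>; instead the complex is empty with probability at least \<open>(1 - 1 / n) ^ n\<close>, which
  tends to \<open>exp (- 1)\<close>.
\<close>

lemma prob_dim_ge_not_tendsto_1:
  assumes \<alpha>: "\<forall>i\<le>r. 0 \<le> \<alpha> i" and s: "s \<le> r" and D: "1 \<le> D r s \<alpha>"
  shows "\<not> prob_dim_ge r \<alpha> s \<longlonglongrightarrow> 1"
proof
  assume lim: "prob_dim_ge r \<alpha> s \<longlonglongrightarrow> 1"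
  show False
  proof (cases "s = 0")
    case True
    have \<alpha>0: "1 \<le> \<alpha> 0"
      using D unfolding True D_def by (simp add: sum.atMost_shift)
    have "prob_dim_ge r \<alpha> s n \<le> 1 - (1 + (- 1) / real n) ^ n" if "1 \<le> n" for n
    proof -
      have "real n powr (- \<alpha> 0) \<le> real n powr (- 1)"
        using that \<alpha>0 by (intro powr_mono) auto
      then have "(1 + (- 1) / real n) ^ n \<le> (1 - real n powr (- \<alpha> 0)) ^ n"
        using that by (intro power_mono) (auto simp: powr_minus_divide)
      then show ?thesis
        unfolding True prob_dim_ge_0[OF \<alpha>] by simp
    qed
    then have "\<forall>\<^sub>F n in sequentially. prob_dim_ge r \<alpha> s n \<le> 1 - (1 + (- 1) / real n) ^ n"
      by (rule eventually_sequentiallyI)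
    moreover have "(\<lambda>n. 1 - (1 + (- 1) / real n) ^ n) \<longlonglongrightarrow> 1 - exp (- 1)"
      by (intro tendsto_intros tendsto_exp_limit_sequentially)
    ultimately have "1 \<le> 1 - exp (- 1 :: real)"
      using tendsto_le[OF _ _ lim] by simp
    then show False
      by simp
  next
    case False
    have "prob_dim_ge r \<alpha> s n \<le> 1 / 2" if n: "1 \<le> n" for n
    proof -
      have "real (Suc s) \<le> face_weight r \<alpha> (Suc s)"
        using D by (simp add: D_eq_face_weight le_divide_eq)
      then have "real n powr (- face_weight r \<alpha> (Suc s)) \<le> real n powr (- real (Suc s))"
        using n by (intro powr_mono) auto
      then have "prob_dim_ge r \<alpha> s n \<le> real (n choose Suc s) * real n powr (- real (Suc s))"
        using prob_dim_ge_upper[OF \<alpha> s, of n] n mult_left_mono[of _ _ "real (n choose Suc s)"] by fastforce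
      also have "\<dots> = real (n choose Suc s) / real n ^ Suc s"
        using n powr_realpow[of "real n" "Suc s"] unfolding powr_minus_divide by simp
      also have "\<dots> \<le> 1 / fact (Suc s)"
      proof -
        have "real (n choose Suc s) * fact (Suc s) \<le> real n ^ Suc s"
          using of_nat_mono[OF binomial_fact_pow[of n "Suc s"], where 'a = real]
          by (simp only: of_nat_mult of_nat_fact of_nat_power)
        then show ?thesis
          using n by (simp add: field_simps del: fact_Suc power_Suc)
      qed
      also have "\<dots> \<le> 1 / fact 2"
        using False by (intro divide_left_mono fact_mono) auto
      finally show ?thesis
        by simp
    qed
    then have "\<forall>\<^sub>F n in sequentially. prob_dim_ge r \<alpha> s n \<le> 1 / 2"
      by (rule eventually_sequentiallyI)
    then have "1 \<le> 1 / (2::real)"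
      by (rule tendsto_upperbound[OF lim]) simp
    then show False
      by simp
  qed
qed

section \<open>Asymptotic dimension\<close>

lemma aas_dim_ge_iff:
  assumes "\<forall>i\<le>r. 0 \<le> \<alpha> i" "s \<le> r"
  shows "aas r \<alpha> (\<lambda>Y. complex_dim Y \<ge> int s) \<longleftrightarrow> D r s \<alpha> < 1"
  unfolding aas_def
  using prob_dim_ge_tendsto_1[OF assms] prob_dim_ge_not_tendsto_1[OF assms] by force

lemma aas_dim_less_iff_prob:
  assumes \<alpha>: "\<forall>i\<le>r. 0 \<le> \<alpha> i"
  shows "aas r \<alpha> (\<lambda>Y. complex_dim Y < int s) \<longleftrightarrow> prob_dim_ge r \<alpha> s \<longlonglongrightarrow> 0"
  unfolding aas_def prob_complement_dim_ge[OF \<alpha>]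
proof
  assume "(\<lambda>n. 1 - prob_dim_ge r \<alpha> s n) \<longlonglongrightarrow> 1"
  from tendsto_diff[OF tendsto_const[of 1] this] show "prob_dim_ge r \<alpha> s \<longlonglongrightarrow> 0"
    by simp
next
  assume "prob_dim_ge r \<alpha> s \<longlonglongrightarrow> 0"
  from tendsto_diff[OF tendsto_const[of 1] this] show "(\<lambda>n. 1 - prob_dim_ge r \<alpha> s n) \<longlonglongrightarrow> 1"
    by simp
qed

lemma aas_dim_less_iff:
  assumes \<alpha>: "\<forall>i\<le>r. 0 \<le> \<alpha> i" and s: "s \<le> r"
  shows "aas r \<alpha> (\<lambda>Y. complex_dim Y < int s) \<longleftrightarrow> D r s \<alpha> > 1"
  unfolding aas_dim_less_iff_prob[OF \<alpha>]
proof
  assume lim: "prob_dim_ge r \<alpha> s \<longlonglongrightarrow> 0"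
  show "D r s \<alpha> > 1"
  proof (rule ccontr)
    assume "\<not> D r s \<alpha> > 1"
    then obtain c where "c > 0" "\<forall>\<^sub>F n in sequentially. c \<le> prob_dim_ge r \<alpha> s n"
      using prob_dim_ge_bounded_below[OF \<alpha> s] by auto
    then show False
      using tendsto_lowerbound[OF lim, of c] by simp
  qed
qed (rule prob_dim_ge_tendsto_0[OF \<alpha> s])

lemma aas_dim_less_Suc_skeleton:
  assumes \<alpha>: "\<forall>i\<le>r. 0 \<le> \<alpha> i"
  shows "aas r \<alpha> (\<lambda>Y. complex_dim Y < int (Suc r))"
proof -
  have "f_num (Suc r) Y = 0" if "Y \<in> subcomplexes n r" for n Y
    using that by (auto simp: f_num_def subcomplexes_def skeleton_def intro!: card_eq_0_iff[THEN iffD2])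
  then have "{Y. Y \<in> subcomplexes n r \<and> real (f_num (Suc r) Y) \<noteq> 0} = {}" for n
    by auto
  then have "prob_dim_ge r \<alpha> (Suc r) n = 0" for n
    unfolding prob_dim_ge_eq[OF \<alpha>] by (simp only: sum.empty)
  then show ?thesis
    unfolding aas_dim_less_iff_prob[OF \<alpha>] by simp
qed

text \<open>
  Since \<open>dim Y = s\<close> has probability \<open>prob_dim_ge r \<alpha> s n - prob_dim_ge r \<alpha> (Suc s) n\<close> and both terms lie
  in \<open>[0, 1]\<close>, the difference tends to \<open>1\<close> only if the terms tend to \<open>1\<close> and \<open>0\<close>.
\<close>

lemma aas_dim_eq_iff:
  assumes \<alpha>: "\<forall>i\<le>r. 0 \<le> \<alpha> i"
  shows "aas r \<alpha> (\<lambda>Y. complex_dim Y = int s) \<longleftrightarrow>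
    aas r \<alpha> (\<lambda>Y. complex_dim Y \<ge> int s) \<and> aas r \<alpha> (\<lambda>Y. complex_dim Y < int (Suc s))"
  unfolding aas_dim_less_iff_prob[OF \<alpha>] unfolding aas_def prob_dim_eq[OF \<alpha>]
proof (intro iffI conjI; (elim conjE)?)
  assume lim: "(\<lambda>n. prob_dim_ge r \<alpha> s n - prob_dim_ge r \<alpha> (Suc s) n) \<longlonglongrightarrow> 1"
  show ge: "prob_dim_ge r \<alpha> s \<longlonglongrightarrow> 1"
    by (rule tendsto_sandwich[OF _ _ lim tendsto_const[of 1]]) (simp_all add: prob_dim_ge_le_1[OF \<alpha>])
  from tendsto_diff[OF ge lim] show "prob_dim_ge r \<alpha> (Suc s) \<longlonglongrightarrow> 0"
    by simp
next
  assume "prob_dim_ge r \<alpha> s \<longlonglongrightarrow> 1" "prob_dim_ge r \<alpha> (Suc s) \<longlonglongrightarrow> 0"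
  from tendsto_diff[OF this]
  show "(\<lambda>n. prob_dim_ge r \<alpha> s n - prob_dim_ge r \<alpha> (Suc s) n) \<longlonglongrightarrow> 1"
    by simp
qed

lemma D_convex_combination: "D r s (\<lambda>i. u * \<alpha> i + v * \<beta> i) = u * D r s \<alpha> + v * D r s \<beta>"
  by (simp add: D_def distrib_left sum.distrib sum_distrib_left mult.left_commute)

lemma convex_params_dim_domain: "convex_params (dim_domain r s)"
  unfolding convex_params_def
proof (intro ballI allI impI)
  fix \<alpha> \<beta> :: "nat \<Rightarrow> real" and u v :: real
  assume *: "\<alpha> \<in> dim_domain r s" "\<beta> \<in> dim_domain r s" "0 \<le> u" "0 \<le> v" "u + v = 1"
  then have "u * D r s \<alpha> + v * D r s \<beta> < 1"
    by (intro convex_bound_lt) (auto simp: dim_domain_def)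
  moreover have "u * (- D r (Suc s) \<alpha>) + v * (- D r (Suc s) \<beta>) < - 1"
    using * by (intro convex_bound_lt) (auto simp: dim_domain_def)
  ultimately show "(\<lambda>i. u * \<alpha> i + v * \<beta> i) \<in> dim_domain r s"
    using * by (auto simp: dim_domain_def D_convex_combination)
qed

theorem corollary5p1:
  fixes r s :: nat and \<alpha> :: "nat \<Rightarrow> real"
  assumes "r \<ge> 1"
    and "\<forall>i\<le>r. 0 \<le> \<alpha> i"
    and "s \<le> r"
  shows "(D r s \<alpha> < 1 \<longrightarrow> aas r \<alpha> (\<lambda>Y. complex_dim Y \<ge> int s))
       \<and> (D r s \<alpha> > 1 \<longrightarrow> aas r \<alpha> (\<lambda>Y. complex_dim Y < int s))
       \<and> (convex_params (dim_domain r s) \<and> dim_domain r s \<subseteq> dim_area r s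
          \<and> (s < r \<longrightarrow> dim_domain r s = dim_area r s))"
proof (intro conjI impI)
  show "aas r \<alpha> (\<lambda>Y. complex_dim Y \<ge> int s)" if "D r s \<alpha> < 1"
    using that aas_dim_ge_iff[OF assms(2,3)] by blast
  show "aas r \<alpha> (\<lambda>Y. complex_dim Y < int s)" if "D r s \<alpha> > 1"
    using that aas_dim_less_iff[OF assms(2,3)] by blast
  show "convex_params (dim_domain r s)"
    by (rule convex_params_dim_domain)
  show eq: "dim_domain r s = dim_area r s" if "s < r"
    using that unfolding dim_domain_def dim_area_def
    by (intro Collect_cong conj_cong refl) (simp add: aas_dim_eq_iff aas_dim_ge_iff aas_dim_less_iff del: of_nat_Suc)
  show "dim_domain r s \<subseteq> dim_area r s"
  proof (cases "s = r")
    case True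
    \<comment> \<open>inside the \<open>r\<close>-skeleton the dimension is at most \<open>r\<close>, so only the lower bound is at stake\<close>
    then show ?thesis
      by (auto simp: dim_domain_def dim_area_def aas_dim_eq_iff aas_dim_ge_iff aas_dim_less_Suc_skeleton simp del: of_nat_Suc)
  next
    case False
    then show ?thesis
      using eq assms(3) by simp
  qed
qed

end
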